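(* For $d\ge1$, let $a$ be the level-$2d$ uniform truncated strategy, i.e. $a_i=\frac12$ for $0\le i<2d$ and $a_i=0$ for $i\ge 2d$. Then $$U_{d,2d}(a)=O(d^2),$$ i.e. there is a constant $C$ such that $U_{d,2d}(a)\le C\,d^2$ for every integer $d\ge1$.
   Context: Fix integers $d\ge1$, $n\ge d$ and $a=(a_1,\dots,a_{n-1})\in[0,1]^{n-1}$. Set $a_0=\frac12$, $a_i=0$ for $i\ge n$, and let $(b_i)_{i\in\mathbb Z}$ be given by $b_i=a_i$ for $i\ge0$ and $b_i=1-a_{-i}$ for $i<0$. The level-$n$ truncated chain is the Markov chain with states $S_{x,y}$, $x,y\in\mathbb Z$, $-n\le x,y\le n$, $x-y\le 2d$, $x-y$ even; states with $x-y=2d$ are absorbing; from any other state $S_{x,y}$ the two coordinates move independently, $x\mapsto x+1$ with probability $b_x$ and $x\mapsto x-1$ with probability $1-b_x$, and $y\mapsto y+1$ with probability $b_y$ and $y\mapsto y-1$ with probability $1-b_y$. $U_{d,n}(a)\in[0,\infty]$ is the expected hitting time of the absorbing set starting from $S_{0,0}$ ($\infty$ if not finite). *)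

theory Defs
  imports "HOL-Probability.Probability"
begin

section \<open>Law of a time-homogeneous Markov chain on a countable state space\<close>

definition chain_step :: "('s \<Rightarrow> 's pmf) \<Rightarrow> 's \<Rightarrow> nat \<Rightarrow> (nat \<Rightarrow> 's) \<Rightarrow> 's measure" where
  "chain_step K s i \<omega> =
     (case i of 0 \<Rightarrow> measure_pmf (return_pmf s) | Suc j \<Rightarrow> measure_pmf (K (\<omega> j)))"

lemma Ionescu_Tulcea_chain_step:
  fixes K :: "'s :: countable \<Rightarrow> 's pmf"
  shows "Ionescu_Tulcea (chain_step K s) (\<lambda>_. count_space UNIV)"
proof (rule Ionescu_Tulcea.intro)
  fix i
  show "chain_step K s i \<in> PiM {0..<i} (\<lambda>_. count_space UNIV) \<rightarrow>\<^sub>M subprob_algebra (count_space UNIV)"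
  proof (cases i)
    case 0
    then show ?thesis
      by (auto simp: chain_step_def [abs_def] intro!: measurable_const measure_pmf_in_subprob_algebra)
  next
    case (Suc j)
    have "(\<lambda>\<omega>. \<omega> j) \<in> PiM {0..<Suc j} (\<lambda>_. count_space (UNIV :: 's set)) \<rightarrow>\<^sub>M count_space UNIV"
      by (rule measurable_component_singleton) auto
    then have "(\<lambda>\<omega>. measure_pmf (K (\<omega> j))) \<in> PiM {0..<Suc j} (\<lambda>_. count_space UNIV) \<rightarrow>\<^sub>M
        subprob_algebra (count_space UNIV)"
      by (rule measurable_compose)
        (auto simp: measurable_def space_subprob_algebra measure_pmf.subprob_space_axioms)
    then show ?thesis
      by (simp add: Suc chain_step_def [abs_def])
  qed
next
  show "prob_space (chain_step K s i \<omega>)" for i and \<omega> :: "nat \<Rightarrow> 's"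
    by (auto simp: chain_step_def measure_pmf.prob_space_axioms split: nat.split)
qed

text \<open>The probability measure on trajectories of the chain with transition kernel \<open>K\<close>
  started in \<open>s\<close>, obtained from the Ionescu-Tulcea theorem.\<close>

definition chain_law :: "('s \<Rightarrow> 's pmf) \<Rightarrow> 's \<Rightarrow> (nat \<Rightarrow> 's) measure" where
  "chain_law K s =
     projective_family.lim UNIV
       (Ionescu_Tulcea.CI (chain_step K s) (\<lambda>_. count_space UNIV)) (\<lambda>_. count_space UNIV)"

lemma emeasure_chain_law_cylinder:
  fixes K :: "'s :: countable \<Rightarrow> 's pmf"
  shows "emeasure (chain_law K s) {\<omega>. \<forall>i\<le>t. \<omega> i = xs i} =
    (if xs 0 = s then \<Prod>i<t. ennreal (pmf (K (xs i)) (xs (Suc i))) else 0)"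
proof -
  let ?M = "\<lambda>_::nat. count_space (UNIV :: 's set)"
  interpret Ionescu_Tulcea "chain_step K s" ?M
    by (rule Ionescu_Tulcea_chain_step)
  define X where "X n = PiE {0..<n} (\<lambda>i. {xs i})" for n :: nat
  have X_sets [measurable]: "X n \<in> sets (PiM {0..<n} ?M)" for n
    unfolding X_def by (rule sets_PiM_I_finite) auto
  have emb: "PF.emb UNIV {0..<Suc t} (X (Suc t)) = {\<omega>. \<forall>i\<le>t. \<omega> i = xs i}"
    by (auto simp: prod_emb_def X_def space_PiM PiE_iff extensional_def restrict_def)
  have X_eq: "X n = {restrict xs {0..<n}}" for n
    by (auto simp: X_def PiE_def Pi_def extensional_def restrict_def fun_eq_iff)
  have ind: "fun_upd \<omega> n x \<in> X (Suc n) \<longleftrightarrow> \<omega> \<in> X n \<and> x = xs n"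
    if "\<omega> \<in> space (PiM {0..<n} ?M)" for \<omega> n x
    using that by (auto simp: X_def space_PiM PiE_iff extensional_def)
  have step: "emeasure (C 0 (Suc n) (\<lambda>_. undefined)) (X (Suc n)) =
      emeasure (C 0 n (\<lambda>_. undefined)) (X n) * emeasure (chain_step K s n (restrict xs {0..<n})) {xs n}" for n
  proof -
    let ?u = "\<lambda>_::nat. undefined :: 's"
    have u: "?u \<in> space (PiM {0..<0} ?M)"
      by (simp add: space_PiM)
    have meas: "eP n \<in> C 0 n ?u \<rightarrow>\<^sub>M subprob_algebra (PiM {0..<Suc n} ?M)"
    proof -
      have "sets (C 0 n ?u) = sets (PiM {0..<n} ?M)"
        using sets_C[OF u, of n] by simp
      from measurable_cong_sets[OF this refl] show ?thesis
        using measurable_eP[of n] by blast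
    qed
    have "emeasure (C 0 (Suc n) ?u) (X (Suc n)) = emeasure (C 0 n ?u \<bind> eP n) (X (Suc n))"
      by simp
    also have "\<dots> = (\<integral>\<^sup>+\<omega>. emeasure (eP n \<omega>) (X (Suc n)) \<partial>C 0 n ?u)"
      by (rule emeasure_bind[OF prob_space.not_empty[OF prob_space_C[OF u]] meas X_sets])
    also have "\<dots> = (\<integral>\<^sup>+\<omega>. emeasure (chain_step K s n (restrict xs {0..<n})) {xs n} *
        indicator (X n) \<omega> \<partial>C 0 n ?u)"
    proof (rule nn_integral_cong)
      fix \<omega> assume "\<omega> \<in> space (C 0 n ?u)"
      then have \<omega>: "\<omega> \<in> space (PiM {0..<n} ?M)"
        using space_C[OF u, of n] by simp
      have "emeasure (eP n \<omega>) (X (Suc n)) =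
          emeasure (chain_step K s n \<omega>) {x. fun_upd \<omega> n x \<in> X (Suc n)}"
        by (subst emeasure_eP[OF \<omega> X_sets]) (simp add: vimage_def)
      also have "\<dots> = emeasure (chain_step K s n \<omega>) (if \<omega> \<in> X n then {xs n} else {})"
        by (rule arg_cong[where f="emeasure _"]) (auto simp: ind[OF \<omega>])
      finally show "emeasure (eP n \<omega>) (X (Suc n)) =
          emeasure (chain_step K s n (restrict xs {0..<n})) {xs n} * indicator (X n) \<omega>"
        by (auto simp: X_eq)
    qed
    also have "\<dots> = emeasure (chain_step K s n (restrict xs {0..<n})) {xs n} *
        emeasure (C 0 n ?u) (X n)"
      using X_sets[of n] sets_C[OF u, of n] by (subst nn_integral_cmult_indicator) auto
    finally show ?thesis
      by (simp add: mult.commute)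
  qed
  have "emeasure (C 0 (Suc t) (\<lambda>_. undefined)) (X (Suc t)) =
      (if xs 0 = s then \<Prod>i<t. ennreal (pmf (K (xs i)) (xs (Suc i))) else 0)"
  proof (induction t)
    case 0
    have "emeasure (C 0 0 (\<lambda>_. undefined)) (X 0) = 1"
      using X_sets[of 0] by (simp add: X_def)
    then show ?case
      by (subst step)
        (simp add: chain_step_def emeasure_pmf_single pmf_return)
  next
    case (Suc t)
    show ?case
      by (subst step, subst Suc.IH) (simp add: chain_step_def emeasure_pmf_single)
  qed
  moreover have "emeasure PF.lim (PF.emb UNIV {0..<Suc t} (X (Suc t))) = CI {0..<Suc t} (X (Suc t))"
    by (rule lim) (rule finite_atLeastLessThan, rule X_sets)
  moreover have "CI {0..<Suc t} (X (Suc t)) =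
      C 0 (Suc t) (\<lambda>_. undefined) (PF.emb {0..<Suc t} {0..<Suc t} (X (Suc t)))"
    by (rule emeasure_CI[OF subset_refl X_sets])
  moreover have "PF.emb {0..<Suc t} {0..<Suc t} (X (Suc t)) = X (Suc t)"
    by (rule prod_emb_id) (auto simp: X_def)
  ultimately have "emeasure PF.lim (PF.emb UNIV {0..<Suc t} (X (Suc t))) =
      (if xs 0 = s then \<Prod>i<t. ennreal (pmf (K (xs i)) (xs (Suc i))) else 0)"
    by presburger
  then show ?thesis
    by (simp only: emb chain_law_def)
qed

definition hitting_time :: "'s set \<Rightarrow> (nat \<Rightarrow> 's) \<Rightarrow> ennreal" where
  "hitting_time A \<omega> = (INF t \<in> {t. \<omega> t \<in> A}. of_nat t)"

definition expected_hitting_time :: "('s \<Rightarrow> 's pmf) \<Rightarrow> 's \<Rightarrow> 's set \<Rightarrow> ennreal" where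
  "expected_hitting_time K s A = (\<integral>\<^sup>+\<omega>. hitting_time A \<omega> \<partial>chain_law K s)"


section \<open>The truncated chain\<close>

text \<open>A strategy is a function on the natural numbers of which only the values at
  \<open>1, \<dots>, n - 1\<close> are used.\<close>

definition truncated :: "nat \<Rightarrow> (nat \<Rightarrow> real) \<Rightarrow> nat \<Rightarrow> real" where
  "truncated n a i = (if i = 0 then 1/2 else if i < n then a i else 0)"

definition up_prob :: "nat \<Rightarrow> (nat \<Rightarrow> real) \<Rightarrow> int \<Rightarrow> real" where
  "up_prob n a i = (if 0 \<le> i then truncated n a (nat i) else 1 - truncated n a (nat (- i)))"

definition coord_step :: "nat \<Rightarrow> (nat \<Rightarrow> real) \<Rightarrow> int \<Rightarrow> int pmf" where
  "coord_step n a x =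
     map_pmf (\<lambda>up. if up then x + 1 else x - 1) (bernoulli_pmf (up_prob n a x))"

definition chain_states :: "nat \<Rightarrow> nat \<Rightarrow> (int \<times> int) set" where
  "chain_states d n = {(x, y). \<bar>x\<bar> \<le> int n \<and> \<bar>y\<bar> \<le> int n \<and> x - y \<le> 2 * int d \<and> even (x - y)}"

definition absorbing_states :: "nat \<Rightarrow> nat \<Rightarrow> (int \<times> int) set" where
  "absorbing_states d n = {(x, y) \<in> chain_states d n. x - y = 2 * int d}"

text \<open>The kernel is total on pairs of integers; by the next lemma the chain never leaves
  \<^term>\<open>chain_states d n\<close>, so its values elsewhere play no role.\<close>

definition chain_kernel :: "nat \<Rightarrow> nat \<Rightarrow> (nat \<Rightarrow> real) \<Rightarrow> int \<times> int \<Rightarrow> (int \<times> int) pmf" where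
  "chain_kernel d n a = (\<lambda>(x, y).
     if (x, y) \<in> absorbing_states d n then return_pmf (x, y)
     else pair_pmf (coord_step n a x) (coord_step n a y))"

lemma set_coord_step:
  assumes "1 \<le> n" "\<bar>x\<bar> \<le> int n" "x' \<in> set_pmf (coord_step n a x)"
  shows "(x' = x + 1 \<or> x' = x - 1) \<and> \<bar>x'\<bar> \<le> int n"
proof -
  have *: "set_pmf (bernoulli_pmf 0) = {False}" "set_pmf (bernoulli_pmf 1) = {True}"
    by (auto simp: set_pmf_eq) (metis (full_types) diff_self less_eq_real_def pmf_bernoulli_False zero_less_one)
  consider "x = int n" | "x = - int n" | "\<bar>x\<bar> < int n"
    using assms by linarith
  then show ?thesis
  proof cases
    case 1
    then have "up_prob n a x = 0"
      using assms by (simp add: up_prob_def truncated_def)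
    then show ?thesis
      using 1 assms by (auto simp: coord_step_def *)
  next
    case 2
    then have "up_prob n a x = 1"
      using assms by (simp add: up_prob_def truncated_def)
    then show ?thesis
      using 2 assms by (auto simp: coord_step_def *)
  next
    case 3
    then show ?thesis
      using assms by (auto simp: coord_step_def split: if_splits)
  qed
qed

lemma chain_kernel_closed:
  assumes "1 \<le> d" "d \<le> n" "s \<in> chain_states d n" "s' \<in> set_pmf (chain_kernel d n a s)"
  shows "s' \<in> chain_states d n"
proof -
  obtain x y x' y' where s: "s = (x, y)" "s' = (x', y')"
    by fastforce
  show ?thesis
  proof (cases "s \<in> absorbing_states d n")
    case True
    then show ?thesis
      using assms s by (simp add: chain_kernel_def)
  next
    case False
    then have "x' \<in> set_pmf (coord_step n a x)" "y' \<in> set_pmf (coord_step n a y)"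
      using assms s by (auto simp: chain_kernel_def)
    moreover have xy: "\<bar>x\<bar> \<le> int n" "\<bar>y\<bar> \<le> int n" "even (x - y)" "x - y < 2 * int d"
      using assms s False by (auto simp: chain_states_def absorbing_states_def)
    ultimately have x': "x' = x + 1 \<or> x' = x - 1" "\<bar>x'\<bar> \<le> int n"
      and y': "y' = y + 1 \<or> y' = y - 1" "\<bar>y'\<bar> \<le> int n"
      using assms set_coord_step[of n x x' a] set_coord_step[of n y y' a] by auto
    have "x' - y' = x - y + 2 \<or> x' - y' = x - y \<or> x' - y' = x - y - 2"
      using x'(1) y'(1) by auto
    moreover from this have "even (x' - y')"
      using xy(3) by (metis dvd_refl even_add even_diff)
    moreover have "x - y \<le> 2 * int d - 2"
      using xy(3,4) by presburger
    ultimately have "even (x' - y')" "x' - y' \<le> 2 * int d"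
      by auto
    then show ?thesis
      using x'(2) y'(2) by (simp add: s chain_states_def)
  qed
qed

definition U :: "nat \<Rightarrow> nat \<Rightarrow> (nat \<Rightarrow> real) \<Rightarrow> ennreal" where
  "U d n a = expected_hitting_time (chain_kernel d n a) (0, 0) (absorbing_states d n)"

definition uniform_strategy :: "nat \<Rightarrow> nat \<Rightarrow> real" where
  "uniform_strategy n i = (if i < n then 1/2 else 0)"

end

theory Submission
  imports Defs
begin

text \<open>
  The expected hitting time is bounded by any nonnegative function that decreases by at least 1 in
  expectation at every step outside the target. Put \<open>N = 2d\<close>, \<open>s = N - x\<close> and \<open>t = N + y\<close>, so that
  absorption happens on \<open>s + t = N\<close>. The function \<open>1 / (s\<^sup>2 + t\<^sup>2)\<close> is strictly subharmonic for the
  diagonal walk. The boundaries \<open>s = 0\<close> and \<open>t = 0\<close> reflect the walk and the function is even in \<open>s\<close>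
  and in \<open>t\<close>; at the boundaries \<open>s = 2N\<close> and \<open>t = 2N\<close> it decreases outwards, so that the forced step
  inwards only helps. Since \<open>2d\<^sup>2 \<le> s\<^sup>2 + t\<^sup>2 \<le> 32d\<^sup>2\<close> on the states, the increments are at least of
  order \<open>1 / d^4\<close> while the range is of order \<open>1 / d\<^sup>2\<close>, and the quotient is of order \<open>d\<^sup>2\<close>.
\<close>

section \<open>Hitting times and Lyapunov functions\<close>

text \<open>Recursion on the first step makes first-step analysis immediate, in contrast to the
  trajectory measure, which is built by appending states at the end. The list includes the start, so
  it has \<open>t + 1\<close> entries.\<close>

primrec path_pmf :: "('s \<Rightarrow> 's pmf) \<Rightarrow> nat \<Rightarrow> 's \<Rightarrow> 's list pmf" where
  "path_pmf K 0 s = return_pmf [s]"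
| "path_pmf K (Suc t) s = bind_pmf (K s) (\<lambda>y. map_pmf (Cons s) (path_pmf K t y))"

lemma length_path_pmf: "xs \<in> set_pmf (path_pmf K t s) \<Longrightarrow> length xs = Suc t"
  by (induction t arbitrary: s xs) auto

text \<open>The right-hand side has the form of the cylinder probability of
  \<open>chain_law\<close>, which is how the two laws get identified.\<close>

lemma pmf_path_pmf:
  assumes "length xs = Suc t"
  shows "ennreal (pmf (path_pmf K t s) xs) =
    (if xs ! 0 = s then \<Prod>i<t. ennreal (pmf (K (xs ! i)) (xs ! Suc i)) else 0)"
  using assms
proof (induction t arbitrary: s xs)
  case 0
  then show ?case
    by (cases xs) (auto simp: pmf_return)
next
  case (Suc t)
  then obtain x ys where xs: "xs = x # ys" "length ys = Suc t"
    by (cases xs) auto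
  have cons: "pmf (map_pmf (Cons s) p) (x # ys) = (if x = s then pmf p ys else 0)" for p
    by (auto simp: pmf_map_inj' inj_def pmf_eq_0_set_pmf)
  have "ennreal (pmf (path_pmf K (Suc t) s) xs) =
      (\<integral>\<^sup>+y. (if x = s then ennreal (pmf (path_pmf K t y) ys) else 0) \<partial>K s)"
    unfolding path_pmf.simps ennreal_pmf_bind xs cons by (intro nn_integral_cong) simp
  \<comment> \<open>By the induction hypothesis the integrand vanishes unless \<open>y\<close> is
    the head of \<open>ys\<close>, so the integral reduces to one atom.\<close>
  also have "\<dots> = (\<integral>\<^sup>+y. (if x = s then \<Prod>i<t. ennreal (pmf (K (ys ! i)) (ys ! Suc i)) else 0)
      * indicator {ys ! 0} y \<partial>K s)"
    by (intro nn_integral_cong) (auto simp: Suc.IH[OF xs(2)])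
  also have "\<dots> = (if x = s then \<Prod>i<t. ennreal (pmf (K (ys ! i)) (ys ! Suc i)) else 0)
      * ennreal (pmf (K s) (ys ! 0))"
    by (subst nn_integral_cmult_indicator) (auto simp: emeasure_pmf_single)
  finally show ?case
    by (auto simp: xs prod.lessThan_Suc_shift mult.commute simp del: prod.lessThan_Suc path_pmf.simps)
qed

lemma sets_chain_law:
  fixes K :: "'s :: countable \<Rightarrow> 's pmf"
  shows "sets (chain_law K s) = sets (PiM UNIV (\<lambda>_. count_space UNIV))"
proof -
  interpret Ionescu_Tulcea "chain_step K s" "\<lambda>_. count_space UNIV"
    by (rule Ionescu_Tulcea_chain_step)
  show ?thesis
    by (simp add: chain_law_def)
qed

lemma space_chain_law:
  fixes K :: "'s :: countable \<Rightarrow> 's pmf"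
  shows "space (chain_law K s) = UNIV"
  using sets_eq_imp_space_eq[OF sets_chain_law[of K s]] by (simp add: space_PiM PiE_UNIV_domain)

text \<open>There are only countably many lists over a countable type, so it suffices to treat
  preimages of singletons, which are cylinders or empty.\<close>

lemma measurable_chain_law_prefix:
  fixes K :: "'s :: countable \<Rightarrow> 's pmf"
  shows "(\<lambda>\<omega>. map \<omega> [0..<n]) \<in> chain_law K s \<rightarrow>\<^sub>M count_space UNIV"
proof -
  have "{\<omega>. map \<omega> [0..<n] = xs} \<in> sets (chain_law K s)" for xs :: "'s list"
  proof -
    have "{\<omega> \<in> space (PiM UNIV (\<lambda>_::nat. count_space (UNIV :: 's set))). \<forall>i<n. \<omega> i = xs ! i}
        \<in> sets (PiM UNIV (\<lambda>_. count_space UNIV))"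
      by measurable
    moreover have "{\<omega>. map \<omega> [0..<n] = xs} =
        (if length xs = n then {\<omega>. \<forall>i<n. \<omega> i = xs ! i} else {})"
      by (auto simp: list_eq_iff_nth_eq)
    ultimately show ?thesis
      by (auto simp: sets_chain_law space_PiM PiE_UNIV_domain)
  qed
  then show ?thesis
    by (subst measurable_count_space_eq2_countable)
      (auto simp: space_chain_law vimage_def)
qed

text \<open>Both measures live on a countable set and agree on singletons by the cylinder formula.
  This transfers questions about trajectories to discrete distributions on lists.\<close>

lemma distr_chain_law_prefix:
  fixes K :: "'s :: countable \<Rightarrow> 's pmf"
  shows "distr (chain_law K s) (count_space UNIV) (\<lambda>\<omega>. map \<omega> [0..<Suc t]) =
    measure_pmf (path_pmf K t s)"
proof (rule measure_eqI_countable[where A = UNIV])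
  fix xs :: "'s list"
  have "emeasure (distr (chain_law K s) (count_space UNIV) (\<lambda>\<omega>. map \<omega> [0..<Suc t])) {xs} =
      emeasure (chain_law K s) {\<omega>. map \<omega> [0..<Suc t] = xs}"
    using measurable_chain_law_prefix[of "Suc t" K s]
    by (subst emeasure_distr) (auto simp: space_chain_law vimage_def simp del: upt_Suc)
  also have "\<dots> = ennreal (pmf (path_pmf K t s) xs)"
  proof (cases "length xs = Suc t")
    case True
    then have "{\<omega>. map \<omega> [0..<Suc t] = xs} = {\<omega>. \<forall>i\<le>t. \<omega> i = xs ! i}"
      by (auto simp: list_eq_iff_nth_eq less_Suc_eq_le simp del: upt_Suc)
    then show ?thesis
      by (simp only: emeasure_chain_law_cylinder pmf_path_pmf[OF True])
  next
    case False
    then have "{\<omega>. map \<omega> [0..<Suc t] = xs} = {}"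
      by auto
    moreover have "pmf (path_pmf K t s) xs = 0"
      using False length_path_pmf by (metis pmf_eq_0_set_pmf)
    ultimately show ?thesis
      by (simp only: emeasure_empty ennreal_0)
  qed
  finally show "emeasure (distr (chain_law K s) (count_space UNIV) (\<lambda>\<omega>. map \<omega> [0..<Suc t])) {xs} =
      emeasure (measure_pmf (path_pmf K t s)) {xs}"
    by (simp only: emeasure_pmf_single)
qed auto

section \<open>Hitting times as tail sums\<close>

text \<open>Each time before the first hit contributes 1 to the sum.\<close>

lemma hitting_time_le_suminf:
  "hitting_time A \<omega> \<le> (\<Sum>t. indicator {\<omega>. \<forall>i\<le>t. \<omega> i \<notin> A} \<omega>)"
proof (cases "\<exists>t. \<omega> t \<in> A")
  case True
  define T where "T = (LEAST t. \<omega> t \<in> A)"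
  have "\<omega> T \<in> A"
    unfolding T_def using True by (auto intro: LeastI_ex)
  then have "hitting_time A \<omega> \<le> of_nat T"
    unfolding hitting_time_def by (auto intro: INF_lower)
  also have "\<dots> = (\<Sum>t<T. indicator {\<omega>. \<forall>i\<le>t. \<omega> i \<notin> A} \<omega>)"
  proof -
    have "\<omega> i \<notin> A" if "i < T" for i
      using that unfolding T_def by (rule not_less_Least)
    then have "indicator {\<omega>. \<forall>i\<le>t. \<omega> i \<notin> A} \<omega> = (1 :: ennreal)" if "t < T" for t
      using that by simp
    then show ?thesis
      by simp
  qed
  also have "\<dots> \<le> (\<Sum>t. indicator {\<omega>. \<forall>i\<le>t. \<omega> i \<notin> A} \<omega>)"
    by (rule sum_le_suminf) auto
  finally show ?thesis .
next
  case False
  \<comment> \<open>Without a hit every summand is 1, so the partial sums are unbounded and the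
    series is infinite.\<close>
  have "of_nat n \<le> (\<Sum>t. indicator {\<omega>. \<forall>i\<le>t. \<omega> i \<notin> A} \<omega> :: ennreal)" for n
    using False sum_le_suminf[of "\<lambda>t. indicator {\<omega>. \<forall>i\<le>t. \<omega> i \<notin> A} \<omega> :: ennreal" "{..<n}"]
    by simp
  then have "(SUP n. of_nat n) \<le> (\<Sum>t. indicator {\<omega>. \<forall>i\<le>t. \<omega> i \<notin> A} \<omega> :: ennreal)"
    by (rule SUP_least)
  then show ?thesis
    by (simp add: ennreal_SUP_of_nat_eq_top top_unique)
qed

text \<open>Integrating the tail sum termwise leaves the probabilities that the first
  \<open>t + 1\<close> states avoid \<open>A\<close>, which the path law expresses.\<close>

lemma expected_hitting_time_le_suminf:
  fixes K :: "'s :: countable \<Rightarrow> 's pmf"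
  shows "expected_hitting_time K s A \<le>
    (\<Sum>t. emeasure (measure_pmf (path_pmf K t s)) {xs. set xs \<inter> A = {}})"
proof -
  have eq: "(\<lambda>\<omega>. map \<omega> [0..<Suc t]) -` {xs. set xs \<inter> A = {}} = {\<omega>. \<forall>i\<le>t. \<omega> i \<notin> A}" for t
  proof -
    have "set (map \<omega> [0..<Suc t]) = \<omega> ` {..t}" for \<omega> :: "nat \<Rightarrow> 's"
      by (simp only: set_map set_upt atLeast0LessThan lessThan_Suc_atMost)
    then show ?thesis
      by (auto simp only: vimage_def mem_Collect_eq disjoint_iff image_iff atMost_iff)
  qed
  have meas: "{\<omega>. \<forall>i\<le>t. \<omega> i \<notin> A} \<in> sets (chain_law K s)" for t
    using measurable_sets[OF measurable_chain_law_prefix[of "Suc t" K s],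
        of "{xs. set xs \<inter> A = {}}"]
    unfolding eq by (simp add: space_chain_law)
  have "expected_hitting_time K s A \<le>
      (\<integral>\<^sup>+\<omega>. (\<Sum>t. indicator {\<omega>. \<forall>i\<le>t. \<omega> i \<notin> A} \<omega>) \<partial>chain_law K s)"
    unfolding expected_hitting_time_def by (intro nn_integral_mono hitting_time_le_suminf)
  also have "\<dots> = (\<Sum>t. emeasure (chain_law K s) {\<omega>. \<forall>i\<le>t. \<omega> i \<notin> A})"
    using meas by (subst nn_integral_suminf) auto
  also have "\<dots> = (\<Sum>t. emeasure (measure_pmf (path_pmf K t s)) {xs. set xs \<inter> A = {}})"
    using measurable_chain_law_prefix
    by (subst distr_chain_law_prefix[symmetric], subst emeasure_distr)
      (simp_all only: eq space_chain_law Int_UNIV_right sets_count_space Pow_UNIV UNIV_I)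
  finally show ?thesis .
qed

section \<open>First-step analysis and the drift criterion\<close>

lemma emeasure_path_pmf_avoid_Suc:
  assumes "s \<notin> A"
  shows "emeasure (measure_pmf (path_pmf K (Suc t) s)) {xs. set xs \<inter> A = {}} =
    (\<integral>\<^sup>+y. emeasure (measure_pmf (path_pmf K t y)) {xs. set xs \<inter> A = {}} \<partial>K s)"
proof -
  have "(#) s -` {xs. set xs \<inter> A = {}} = {xs. set xs \<inter> A = {}}"
    using assms by auto
  then show ?thesis
    by (simp add: emeasure_bind_pmf)
qed

lemma start_in_path_pmf: "xs \<in> set_pmf (path_pmf K t s) \<Longrightarrow> s \<in> set xs"
  by (cases t) auto

text \<open>Induction on the length of the partial sums, for all starting states in \<open>S\<close>
  at once: the term at time 0 costs at most 1, the rest is an average over the successors, and the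
  drift condition absorbs both. The bound then passes to the supremum.\<close>

lemma expected_hitting_time_le_Lyapunov:
  fixes K :: "'s :: countable \<Rightarrow> 's pmf" and V :: "'s \<Rightarrow> ennreal"
  assumes closed: "\<And>s s'. s \<in> S \<Longrightarrow> s' \<in> set_pmf (K s) \<Longrightarrow> s' \<in> S"
    and drift: "\<And>s. s \<in> S \<Longrightarrow> s \<notin> A \<Longrightarrow> 1 + (\<integral>\<^sup>+y. V y \<partial>K s) \<le> V s"
    and "s \<in> S"
  shows "expected_hitting_time K s A \<le> V s"
proof -
  let ?p = "\<lambda>t s. emeasure (measure_pmf (path_pmf K t s)) {xs. set xs \<inter> A = {}}"
  have "(\<Sum>t<n. ?p t s) \<le> V s" if "s \<in> S" for n s
    using that
  proof (induction n arbitrary: s)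
    case 0
    then show ?case
      by simp
  next
    case (Suc n)
    show ?case
    proof (cases "s \<in> A")
      case True
      \<comment> \<open>Every path contains its start, so from \<open>A\<close> all avoidance
        probabilities vanish.\<close>
      have "AE xs in measure_pmf (path_pmf K t s). \<not> set xs \<inter> A = {}" for t
        using True start_in_path_pmf unfolding AE_measure_pmf_iff by fast
      then have "?p t s = 0" for t
        using emeasure_eq_0_AE[of "\<lambda>xs. set xs \<inter> A = {}" "measure_pmf (path_pmf K t s)"] by simp
      then show ?thesis
        by simp
    next
      case False
      have "(\<Sum>t<Suc n. ?p t s) = ?p 0 s + (\<Sum>t<n. \<integral>\<^sup>+y. ?p t y \<partial>K s)"
        unfolding sum.lessThan_Suc_shift emeasure_path_pmf_avoid_Suc[OF False] ..
      also have "\<dots> = ?p 0 s + (\<integral>\<^sup>+y. (\<Sum>t<n. ?p t y) \<partial>K s)"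
        by (subst nn_integral_sum) auto
      also have "\<dots> \<le> 1 + (\<integral>\<^sup>+y. V y \<partial>K s)"
        using Suc closed
        by (intro add_mono measure_pmf.emeasure_le_1 nn_integral_mono_AE) (auto simp: AE_measure_pmf_iff)
      also have "\<dots> \<le> V s"
        using drift Suc.prems False by blast
      finally show ?thesis .
    qed
  qed
  then have "(\<Sum>t. ?p t s) \<le> V s"
    unfolding suminf_eq_SUP using assms(3) by (intro SUP_least)
  then show ?thesis
    using expected_hitting_time_le_suminf order_trans by blast
qed

section \<open>The uniform strategy\<close>

lemma up_prob_uniform:
  assumes "0 < n" "\<bar>x\<bar> \<le> int n"
  shows "up_prob n (uniform_strategy n) x = (if x = int n then 0 else if x = - int n then 1 else 1/2)"
  using assms by (auto simp: up_prob_def truncated_def uniform_strategy_def)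

text \<open>The forced steps at \<open>\<plusminus>n\<close> are compared with free steps that would leave the interval.\<close>

lemma nn_integral_coord_step_uniform_le:
  fixes g :: "int \<Rightarrow> ennreal"
  assumes "0 < n" "\<bar>x\<bar> \<le> int n"
    and right: "x = int n \<Longrightarrow> g (x - 1) \<le> g (x + 1)"
    and left: "x = - int n \<Longrightarrow> g (x + 1) \<le> g (x - 1)"
  shows "(\<integral>\<^sup>+x'. g x' \<partial>coord_step n (uniform_strategy n) x) \<le> ennreal (1/2) * (g (x + 1) + g (x - 1))"
proof -
  have half: "u \<le> ennreal (1/2) * (v + u)" if "u \<le> v" for u v :: ennreal
  proof -
    have "u = (ennreal (1/2) + ennreal (1/2)) * u"
      by (subst ennreal_plus[symmetric]) auto
    also have "\<dots> = ennreal (1/2) * (u + u)"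
      by (simp add: distrib_left distrib_right)
    also have "\<dots> \<le> ennreal (1/2) * (v + u)"
      using that by (intro mult_left_mono add_mono) auto
    finally show ?thesis .
  qed
  have eq: "(\<integral>\<^sup>+x'. g x' \<partial>coord_step n (uniform_strategy n) x) =
      g (x + 1) * ennreal (up_prob n (uniform_strategy n) x) +
      g (x - 1) * ennreal (1 - up_prob n (uniform_strategy n) x)"
    unfolding coord_step_def using assms
    by (simp add: up_prob_uniform)
  show ?thesis
    unfolding eq up_prob_uniform[OF assms(1,2)]
    using half[OF right] half[OF left] by (auto simp: distrib_left mult.commute add.commute)
qed

section \<open>Subharmonicity of the inverse squared norm\<close>

text \<open>Opposite diagonal neighbours have squared norms \<open>q + 2\<close> plus and minus
  \<open>2 * \<alpha>\<close> (or \<open>2 * \<beta>\<close>), so pairing them gives the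
  denominators \<open>A\<close> and \<open>B\<close>. The sum \<open>A + B\<close> depends on
  \<open>q\<close> only, and bounding \<open>A * B\<close> from above bounds the average from below
  by \<open>(q + 2) / (q\<^sup>2 + 4)\<close>.\<close>

lemma inverse_sum_squares_subharmonic:
  fixes s t :: real
  assumes "0 \<le> s" "0 \<le> t" "2 < s + t" "4 \<le> s\<^sup>2 + t\<^sup>2"
  shows "1 / (s\<^sup>2 + t\<^sup>2) + 1 / (2 * (s\<^sup>2 + t\<^sup>2)\<^sup>2) \<le>
    (1 / ((s+1)\<^sup>2 + (t+1)\<^sup>2) + 1 / ((s+1)\<^sup>2 + (t-1)\<^sup>2) +
     1 / ((s-1)\<^sup>2 + (t+1)\<^sup>2) + 1 / ((s-1)\<^sup>2 + (t-1)\<^sup>2)) / 4"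
proof -
  define q where "q = s\<^sup>2 + t\<^sup>2"
  define \<alpha> where "\<alpha> = s + t"
  define \<beta> where "\<beta> = s - t"
  have q: "4 \<le> q"
    using assms by (simp add: q_def)
  have ab: "\<alpha>\<^sup>2 + \<beta>\<^sup>2 = 2 * q"
    by (simp add: \<alpha>_def \<beta>_def q_def power2_eq_square algebra_simps)
  \<comment> \<open>The condition \<open>2 < s + t\<close> excludes the point (1, 1), which has the
    origin as a neighbour.\<close>
  have pos: "0 < (s+1)\<^sup>2 + (t+1)\<^sup>2" "0 < (s+1)\<^sup>2 + (t-1)\<^sup>2"
    "0 < (s-1)\<^sup>2 + (t+1)\<^sup>2" "0 < (s-1)\<^sup>2 + (t-1)\<^sup>2"
    using assms by (auto simp: sum_power2_gt_zero_iff)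
  have nb: "(s+1)\<^sup>2 + (t+1)\<^sup>2 = (q + 2) + 2 * \<alpha>" "(s-1)\<^sup>2 + (t-1)\<^sup>2 = (q + 2) - 2 * \<alpha>"
    "(s+1)\<^sup>2 + (t-1)\<^sup>2 = (q + 2) + 2 * \<beta>" "(s-1)\<^sup>2 + (t+1)\<^sup>2 = (q + 2) - 2 * \<beta>"
    by (simp_all add: \<alpha>_def \<beta>_def q_def power2_eq_square algebra_simps)
  define A where "A = (q + 2)\<^sup>2 - 4 * \<alpha>\<^sup>2"
  define B where "B = (q + 2)\<^sup>2 - 4 * \<beta>\<^sup>2"
  have A: "A = ((q + 2) + 2 * \<alpha>) * ((q + 2) - 2 * \<alpha>)" and B: "B = ((q + 2) + 2 * \<beta>) * ((q + 2) - 2 * \<beta>)"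
    by (simp_all add: A_def B_def power2_eq_square algebra_simps)
  have AB: "0 < A" "0 < B"
    using pos unfolding A B nb by simp_all
  have sum: "A + B = 2 * (q\<^sup>2 + 4)"
    using ab by (simp add: A_def B_def power2_eq_square algebra_simps)
  text \<open>AM-GM, with equality at the points of the axes.\<close>
  have "4 * (A * B) \<le> (A + B)\<^sup>2"
    using zero_le_power2[of "A - B"] by (simp add: power2_eq_square algebra_simps)
  then have prod: "A * B \<le> (q\<^sup>2 + 4)\<^sup>2"
    unfolding sum by (simp add: power2_eq_square algebra_simps)
  have pair: "1 / (u + v) + 1 / (u - v) = 2 * u / ((u + v) * (u - v))"
    if "0 < u + v" "0 < u - v" for u v :: real
    using that by (simp add: field_simps)
  have "1 / q + 1 / (2 * q\<^sup>2) \<le> (q + 2) / (q\<^sup>2 + 4)"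
  proof -
    have "4 * q \<le> q * q"
      using q by simp
    moreover have "(q + 2) * (2 * q\<^sup>2) - (2 * q + 1) * (q\<^sup>2 + 4) = 3 * (q * q) - 8 * q - 4"
      by (simp add: power2_eq_square algebra_simps)
    ultimately have "(2 * q + 1) * (q\<^sup>2 + 4) \<le> (q + 2) * (2 * q\<^sup>2)"
      using q by linarith
    moreover have "1 / q + 1 / (2 * q\<^sup>2) = (2 * q + 1) / (2 * q\<^sup>2)"
      using q by (simp add: power2_eq_square field_simps)
    moreover have "0 < q\<^sup>2 + 4"
      by (simp add: add_nonneg_pos)
    ultimately show ?thesis
      using q by (simp add: divide_le_eq pos_le_divide_eq divide_simps)
  qed
  \<comment> \<open>Expanded so that the denominator is the square which bounds
    \<open>A * B\<close>.\<close>
  also have "\<dots> = (q + 2) * (q\<^sup>2 + 4) / (q\<^sup>2 + 4)\<^sup>2"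
    by (simp add: power2_eq_square)
  also have "\<dots> \<le> (q + 2) * (q\<^sup>2 + 4) / (A * B)"
    using prod AB q by (intro frac_le mult_nonneg_nonneg) auto
  also have "\<dots> = (q + 2) / 2 * ((A + B) / (A * B))"
    unfolding sum using AB by (simp add: field_simps)
  also have "\<dots> = (2 * (q + 2) / A + 2 * (q + 2) / B) / 4"
    using AB by (simp add: field_simps)
  also have "\<dots> = ((1 / ((q+2) + 2*\<alpha>) + 1 / ((q+2) - 2*\<alpha>)) + (1 / ((q+2) + 2*\<beta>) + 1 / ((q+2) - 2*\<beta>))) / 4"
    using pos unfolding nb A B by (subst pair, simp, simp, subst pair) auto
  finally show ?thesis
    unfolding nb q_def[symmetric] by (simp add: algebra_simps)
qed

section \<open>The Lyapunov function and its drift\<close>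

text \<open>The squared distance is taken to the corner (2d, -2d), which lies beyond the absorbing
  line. The constant \<open>1 / (2 * (real d)\<^sup>2)\<close> is the value of the inverse at the
  point of that line nearest to the corner and keeps the function nonnegative. The factor is
  \<open>2 * (32 * (real d)\<^sup>2)\<^sup>2\<close>, which turns the gain
  \<open>1 / (2 * q\<^sup>2)\<close> into at least 1 when
  \<open>q \<le> 32 * (real d)\<^sup>2\<close>.\<close>

definition lyapunov :: "nat \<Rightarrow> int \<Rightarrow> int \<Rightarrow> real" where
  "lyapunov d x y = 2048 * (real d)^4 *
     (1 / (2 * (real d)\<^sup>2) - 1 / ((2 * real d - real_of_int x)\<^sup>2 + (2 * real d + real_of_int y)\<^sup>2))"

lemma lyapunov_mono:
  assumes "0 < (2 * real d - of_int x)\<^sup>2 + (2 * real d + of_int y)\<^sup>2"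
    and "(2 * real d - of_int x)\<^sup>2 + (2 * real d + of_int y)\<^sup>2 \<le>
      (2 * real d - of_int x')\<^sup>2 + (2 * real d + of_int y')\<^sup>2"
  shows "lyapunov d x y \<le> lyapunov d x' y'"
  unfolding lyapunov_def using assms
  by (intro mult_left_mono diff_left_mono divide_left_mono mult_pos_pos) auto

text \<open>The parallelogram law applied to a sum of at least \<open>2 * real d\<close>. Nothing
  confines \<open>x\<close> and \<open>y\<close> to the square, so fictitious neighbours outside it
  are covered too.\<close>

lemma sum_squares_ge:
  assumes "x - y \<le> 2 * int d"
  shows "2 * (real d)\<^sup>2 \<le> (2 * real d - of_int x)\<^sup>2 + (2 * real d + of_int y)\<^sup>2"
proof -
  define s where "s = 2 * real d - of_int x"
  define t where "t = 2 * real d + of_int y"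
  have "2 * real d \<le> s + t"
    using assms unfolding s_def t_def by linarith
  then have "(2 * real d)\<^sup>2 \<le> (s + t)\<^sup>2"
    by (intro power_mono) auto
  moreover have "(s + t)\<^sup>2 + (s - t)\<^sup>2 = 2 * (s\<^sup>2 + t\<^sup>2)"
    by (simp add: power2_eq_square algebra_simps)
  ultimately have "(2 * real d)\<^sup>2 \<le> 2 * (s\<^sup>2 + t\<^sup>2)"
    using zero_le_power2[of "s - t"] by linarith
  then show ?thesis
    by (simp add: s_def t_def power_mult_distrib)
qed

lemma lyapunov_nonneg:
  assumes "1 \<le> d" "x - y \<le> 2 * int d"
  shows "0 \<le> lyapunov d x y"
proof -
  have "0 < 2 * (real d)\<^sup>2"
    using assms by simp
  moreover note sum_squares_ge[OF assms(2)]
  ultimately have "1 / ((2 * real d - of_int x)\<^sup>2 + (2 * real d + of_int y)\<^sup>2) \<le> 1 / (2 * (real d)\<^sup>2)"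
    by (rule frac_le[rotated 2]) simp_all
  then show ?thesis
    unfolding lyapunov_def by simp
qed

text \<open>This is the drift of the free diagonal walk, whose neighbours may lie outside the
  square; reflection is treated separately.\<close>

lemma lyapunov_step:
  assumes "1 \<le> d" "\<bar>x\<bar> \<le> 2 * int d" "\<bar>y\<bar> \<le> 2 * int d" "x - y \<le> 2 * int d - 2"
  shows "1 + (lyapunov d (x+1) (y+1) + lyapunov d (x-1) (y+1) +
      lyapunov d (x+1) (y-1) + lyapunov d (x-1) (y-1)) / 4 \<le> lyapunov d x y"
proof -
  define s where "s = 2 * real d - of_int x"
  define t where "t = 2 * real d + of_int y"
  define c where "c = 2048 * (real d)^4"
  define q where "q = s\<^sup>2 + t\<^sup>2"
  have d: "1 \<le> real d"
    using assms by simp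
  have st: "0 \<le> s" "0 \<le> t" "2 * real d + 2 \<le> s + t" "s \<le> 4 * real d" "t \<le> 4 * real d"
    using assms unfolding s_def t_def by linarith+
  have "4\<^sup>2 \<le> (s + t)\<^sup>2"
    using st d by (intro power_mono) linarith+
  then have "16 \<le> (s + t)\<^sup>2"
    by simp
  moreover have "(s + t)\<^sup>2 + (s - t)\<^sup>2 = 2 * q"
    by (simp add: q_def power2_eq_square algebra_simps)
  ultimately have q4: "4 \<le> q"
    using zero_le_power2[of "s - t"] by linarith
  have "q \<le> (4 * real d)\<^sup>2 + (4 * real d)\<^sup>2"
    unfolding q_def using st by (intro add_mono power_mono) auto
  then have "q\<^sup>2 \<le> (32 * (real d)\<^sup>2)\<^sup>2"
    using q4 by (intro power_mono) (auto simp: power2_eq_square)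
  then have "2 * q\<^sup>2 \<le> c"
    by (simp add: c_def power_mult_distrib flip: power_mult)
  then have one: "1 \<le> c * (1 / (2 * q\<^sup>2))"
    using q4 by simp
  have c: "0 \<le> c"
    by (simp add: c_def)
  have sub: "1 / q + 1 / (2 * q\<^sup>2) \<le>
    (1 / ((s+1)\<^sup>2 + (t+1)\<^sup>2) + 1 / ((s+1)\<^sup>2 + (t-1)\<^sup>2) +
     1 / ((s-1)\<^sup>2 + (t+1)\<^sup>2) + 1 / ((s-1)\<^sup>2 + (t-1)\<^sup>2)) / 4" (is "_ \<le> ?m / 4")
    using inverse_sum_squares_subharmonic[of s t] st d q4 unfolding q_def by linarith
  have L: "lyapunov d x y = c * (1 / (2 * (real d)\<^sup>2) - 1 / q)"
    "lyapunov d (x+1) (y+1) = c * (1 / (2 * (real d)\<^sup>2) - 1 / ((s-1)\<^sup>2 + (t+1)\<^sup>2))"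
    "lyapunov d (x-1) (y+1) = c * (1 / (2 * (real d)\<^sup>2) - 1 / ((s+1)\<^sup>2 + (t+1)\<^sup>2))"
    "lyapunov d (x+1) (y-1) = c * (1 / (2 * (real d)\<^sup>2) - 1 / ((s-1)\<^sup>2 + (t-1)\<^sup>2))"
    "lyapunov d (x-1) (y-1) = c * (1 / (2 * (real d)\<^sup>2) - 1 / ((s+1)\<^sup>2 + (t-1)\<^sup>2))"
    by (simp_all add: lyapunov_def c_def q_def s_def t_def algebra_simps)
  have "c * (1 / q + 1 / (2 * q\<^sup>2)) \<le> c * (?m / 4)"
    using sub c by (rule mult_left_mono)
  \<comment> \<open>The constant \<open>k\<close> cancels in the average. The permuted order of the
    terms arises because raising \<open>x\<close> lowers \<open>s\<close>.\<close>
  moreover have "1 + ((k - u1) + (k - u2) + (k - u3) + (k - u4)) / 4 \<le> k - u"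
    if "u + w \<le> (u2 + u4 + u1 + u3) / 4" "1 \<le> w" for k u u1 u2 u3 u4 w :: real
  proof -
    have "1 + ((k - u1) + (k - u2) + (k - u3) + (k - u4)) / 4 = 1 + (k - (u2 + u4 + u1 + u3) / 4)"
      by (simp add: diff_divide_distrib add_divide_distrib)
    also have "\<dots> \<le> w + (k - (u + w))"
      using that by (intro add_mono diff_mono) auto
    finally show ?thesis
      by simp
  qed
  ultimately show ?thesis
    using one unfolding L distrib_left right_diff_distrib times_divide_eq_right by blast
qed

text \<open>First the step in \<open>x\<close> with \<open>y'\<close> fixed, then the step in
  \<open>y\<close>, is replaced by a free step; the drift of the free walk concludes.\<close>

lemma lyapunov_drift:
  assumes d: "1 \<le> d" and "(x, y) \<in> chain_states d (2 * d)" "(x, y) \<notin> absorbing_states d (2 * d)"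
  shows "1 + (\<integral>\<^sup>+z. ennreal (lyapunov d (fst z) (snd z))
      \<partial>chain_kernel d (2 * d) (uniform_strategy (2 * d)) (x, y)) \<le> ennreal (lyapunov d x y)"
proof -
  let ?n = "2 * d"
  let ?a = "uniform_strategy ?n"
  let ?L = "\<lambda>x y. ennreal (lyapunov d x y)"
  have xy: "\<bar>x\<bar> \<le> int ?n" "\<bar>y\<bar> \<le> int ?n" "even (x - y)" "x - y < 2 * int d"
    using assms by (auto simp: chain_states_def absorbing_states_def)
  \<comment> \<open>By parity one step cannot overshoot the absorbing line, so the function is
    nonnegative at all neighbours, including those outside the square.\<close>
  have gap: "x - y \<le> 2 * int d - 2"
    using xy(3,4) by presburger
  have nonneg: "0 \<le> lyapunov d x' y'" if "\<bar>x' - x\<bar> \<le> 1" "\<bar>y' - y\<bar> \<le> 1" for x' y'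
    using that gap by (intro lyapunov_nonneg d) linarith
  have pos: "0 < (2 * real d - of_int x')\<^sup>2 + (2 * real d + of_int y')\<^sup>2"
    if "\<bar>x' - x\<bar> \<le> 1" "\<bar>y' - y\<bar> \<le> 1" for x' y'
  proof -
    have "x' - y' \<le> 2 * int d"
      using that gap by linarith
    moreover have "0 < 2 * (real d)\<^sup>2"
      using d by simp
    ultimately show ?thesis
      using sum_squares_ge order_less_le_trans by blast
  qed
  have stepx: "(\<integral>\<^sup>+x'. ?L x' y' \<partial>coord_step ?n ?a x) \<le> ennreal (1/2) * (?L (x + 1) y' + ?L (x - 1) y')"
    if "\<bar>y' - y\<bar> \<le> 1" for y'
  proof (rule nn_integral_coord_step_uniform_le)
    \<comment> \<open>At the right end the two neighbours are equally far from the corner; at the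
      left end the inward one is closer.\<close>
    show "?L (x - 1) y' \<le> ?L (x + 1) y'" if "x = int ?n"
      using that \<open>\<bar>y' - y\<bar> \<le> 1\<close>
      by (intro ennreal_leI lyapunov_mono pos) (auto simp: power2_eq_square algebra_simps)
    show "?L (x + 1) y' \<le> ?L (x - 1) y'" if "x = - int ?n"
      using that \<open>\<bar>y' - y\<bar> \<le> 1\<close>
      by (intro ennreal_leI lyapunov_mono pos) (auto simp: power2_eq_square algebra_simps)
  qed (use d xy in auto)
  have stepy: "(\<integral>\<^sup>+y'. (\<integral>\<^sup>+x'. ?L x' y' \<partial>coord_step ?n ?a x) \<partial>coord_step ?n ?a y) \<le>
    (\<integral>\<^sup>+y'. ennreal (1/2) * (?L (x + 1) y' + ?L (x - 1) y') \<partial>coord_step ?n ?a y)"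
  proof (intro nn_integral_mono_AE, unfold AE_measure_pmf_iff, intro ballI stepx)
    fix y' assume "y' \<in> set_pmf (coord_step ?n ?a y)"
    then show "\<bar>y' - y\<bar> \<le> 1"
      by (auto simp: coord_step_def)
  qed
  also have "\<dots> \<le> ennreal (1/2) * (ennreal (1/2) * (?L (x + 1) (y + 1) + ?L (x - 1) (y + 1)) +
      ennreal (1/2) * (?L (x + 1) (y - 1) + ?L (x - 1) (y - 1)))"
  proof (rule nn_integral_coord_step_uniform_le)
    show "ennreal (1/2) * (?L (x + 1) (y - 1) + ?L (x - 1) (y - 1)) \<le>
        ennreal (1/2) * (?L (x + 1) (y + 1) + ?L (x - 1) (y + 1))" if "y = int ?n"
      using that
      by (intro mult_left_mono add_mono ennreal_leI lyapunov_mono pos) (auto simp: power2_eq_square algebra_simps)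
    show "ennreal (1/2) * (?L (x + 1) (y + 1) + ?L (x - 1) (y + 1)) \<le>
        ennreal (1/2) * (?L (x + 1) (y - 1) + ?L (x - 1) (y - 1))" if "y = - int ?n"
      using that
      by (intro mult_left_mono add_mono ennreal_leI lyapunov_mono pos) (auto simp: power2_eq_square algebra_simps)
  qed (use d xy in auto)
  also have "\<dots> = ennreal ((lyapunov d (x+1) (y+1) + lyapunov d (x-1) (y+1) +
      lyapunov d (x+1) (y-1) + lyapunov d (x-1) (y-1)) / 4)"
  proof -
    have "ennreal (1/2) * (ennreal (1/2) * (ennreal u + ennreal v) + ennreal (1/2) * (ennreal w + ennreal z)) =
        ennreal ((u + v + w + z) / 4)" if "0 \<le> u" "0 \<le> v" "0 \<le> w" "0 \<le> z" for u v w z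
    proof -
      have "ennreal (1/2) * (ennreal (1/2) * (ennreal u + ennreal v) + ennreal (1/2) * (ennreal w + ennreal z)) =
          ennreal (1/2 * (1/2 * (u + v) + 1/2 * (w + z)))"
        using that by (simp only: ennreal_mult ennreal_plus add_nonneg_nonneg mult_nonneg_nonneg
            zero_le_divide_1_iff zero_le_numeral)
      then show ?thesis
        by (simp add: algebra_simps add_divide_distrib)
    qed
    from this[OF nonneg nonneg nonneg nonneg] show ?thesis
      by simp
  qed
  finally have "1 + (\<integral>\<^sup>+y'. (\<integral>\<^sup>+x'. ?L x' y' \<partial>coord_step ?n ?a x) \<partial>coord_step ?n ?a y) \<le>
     ennreal 1 + ennreal ((lyapunov d (x+1) (y+1) + lyapunov d (x-1) (y+1) +
      lyapunov d (x+1) (y-1) + lyapunov d (x-1) (y-1)) / 4)"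
    by (simp add: add_left_mono)
  also have "\<dots> = ennreal (1 + (lyapunov d (x+1) (y+1) + lyapunov d (x-1) (y+1) +
      lyapunov d (x+1) (y-1) + lyapunov d (x-1) (y-1)) / 4)"
    using nonneg by (subst ennreal_plus) auto
  also have "\<dots> \<le> ?L x y"
    using lyapunov_step[OF d _ _ gap] xy by (intro ennreal_leI) auto
  finally have "1 + (\<integral>\<^sup>+y'. (\<integral>\<^sup>+x'. ?L x' y' \<partial>coord_step ?n ?a x) \<partial>coord_step ?n ?a y) \<le> ?L x y" .
  \<comment> \<open>Commuting the pair makes \<open>y\<close> the outer variable, as in the estimate
    above.\<close>
  moreover have "(\<integral>\<^sup>+z. ?L (fst z) (snd z) \<partial>chain_kernel d ?n ?a (x, y)) =
      (\<integral>\<^sup>+y'. (\<integral>\<^sup>+x'. ?L x' y' \<partial>coord_step ?n ?a x) \<partial>coord_step ?n ?a y)"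
    using assms by (simp add: chain_kernel_def nn_integral_pair_pmf' pair_commute_pmf[of "coord_step ?n ?a x"] split_beta)
  ultimately show ?thesis
    by simp
qed

section \<open>The quadratic bound\<close>

theorem theorem4:
  shows "\<exists>C::real. \<forall>d::nat. d \<ge> 1 \<longrightarrow>
    U d (2 * d) (uniform_strategy (2 * d)) \<le> ennreal (C * (real d)\<^sup>2)"
proof (intro exI allI impI)
  fix d :: nat assume d: "1 \<le> d"
  have "U d (2 * d) (uniform_strategy (2 * d)) \<le> ennreal (lyapunov d (fst (0 :: int, 0 :: int)) (snd (0 :: int, 0 :: int)))"
    unfolding U_def
  proof (rule expected_hitting_time_le_Lyapunov[where S = "chain_states d (2 * d)"
        and V = "\<lambda>z. ennreal (lyapunov d (fst z) (snd z))"])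
    show "s' \<in> chain_states d (2 * d)"
      if "s \<in> chain_states d (2 * d)"
        "s' \<in> set_pmf (chain_kernel d (2 * d) (uniform_strategy (2 * d)) s)" for s s'
      using chain_kernel_closed[OF d _ that] by simp
  next
    fix s assume s: "s \<in> chain_states d (2 * d)" "s \<notin> absorbing_states d (2 * d)"
    show "1 + (\<integral>\<^sup>+y. ennreal (lyapunov d (fst y) (snd y))
        \<partial>chain_kernel d (2 * d) (uniform_strategy (2 * d)) s) \<le> ennreal (lyapunov d (fst s) (snd s))"
      using lyapunov_drift[OF d, of "fst s" "snd s"] s by simp
  qed (auto simp: chain_states_def)
  \<comment> \<open>Dropping the subtracted inverse leaves 2048 d^4 / (2 d^2), hence the constant
    1024.\<close>
  also have "\<dots> \<le> ennreal (1024 * (real d)\<^sup>2)"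
  proof (rule ennreal_leI)
    have le: "k - 1 / (u\<^sup>2 + v\<^sup>2) \<le> k" for k u v :: real
      by simp
    have "lyapunov d (fst (0 :: int, 0 :: int)) (snd (0 :: int, 0 :: int)) \<le> 2048 * (real d)^4 * (1 / (2 * (real d)\<^sup>2))"
      unfolding lyapunov_def by (rule mult_left_mono[OF le]) simp
    also have "\<dots> = 1024 * (real d)\<^sup>2"
      using d by (simp add: power2_eq_square power4_eq_xxxx)
    finally show "lyapunov d (fst (0 :: int, 0 :: int)) (snd (0 :: int, 0 :: int)) \<le> 1024 * (real d)\<^sup>2" .
  qed
  finally show "U d (2 * d) (uniform_strategy (2 * d)) \<le> ennreal (1024 * (real d)\<^sup>2)" .
qed

end
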